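(* Assume that the limits below exist. Then, in the limit $N\to\infty$, the quenched pressure of the diluted two-body (Curie–Weiss) model admits the representation $$A(\alpha,\beta)=\ln 2-\alpha\,\frac{\partial A(\alpha,\beta)}{\partial\alpha}+\Psi(\alpha,\beta;t=1).$$
   Context: Fix $N\in\mathbb N$, a connectivity $\alpha>1/2$ and an inverse temperature $\beta>0$. Spins are $\sigma=(\sigma_1,\dots,\sigma_N)\in\{-1,1\}^N$. Let $P_{\alpha N}$ be a Poisson random variable with mean $\alpha N$, and let $\{i_\nu\},\{j_\nu\}$ be independent families of i.i.d. random variables uniformly distributed on $\{1,\dots,N\}$, independent of $P_{\alpha N}$. The Hamiltonian is $H_N(\sigma,\alpha)=-\sum_{\nu=1}^{P_{\alpha N}}\sigma_{i_\nu}\sigma_{j_\nu}$, the partition function is $Z_N(\alpha,\beta)=\sum_\sigma e^{-\beta H_N(\sigma,\alpha)}$, $\mathbb E$ denotes expectation over all the quenched random variables, $A_N(\alpha,\beta)=\frac1N\mathbb E\ln Z_N(\alpha,\beta)$ and $A(\alpha,\beta)=\lim_{N\to\infty}A_N(\alpha,\beta)$. Set $\tilde\alpha=\frac{N}{N+1}\alpha$. For $t\in[0,1]$ let $P'_{2\tilde\alpha t}$ be a Poisson variable with mean $2\tilde\alpha t$ and $\{k_\nu\}$ i.i.d. uniform on $\{1,\dots,N\}$, all independent of everything else, and define $$Z_{N,t}(\tilde\alpha,\beta)=\sum_\sigma \exp\Big(\beta\sum_{\nu=1}^{P_{\tilde\alpha N}}\sigma_{i_\nu}\sigma_{j_\nu}+\beta\sum_{\nu=1}^{P'_{2\tilde\alpha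 t}}\sigma_{k_\nu}\Big),$$ the cavity function $\Psi_N(\tilde\alpha,\beta;t)=\mathbb E\ln\big(Z_{N,t}(\tilde\alpha,\beta)/Z_N(\tilde\alpha,\beta)\big)$ and $\Psi(\alpha,\beta;t)=\lim_{N\to\infty}\Psi_N(\tilde\alpha,\beta;t)$. *)

theory Defs
  imports "HOL-Probability.Probability"
begin

text \<open>Spin configurations on sites 0..N-1 (the paper's sites 1..N, shifted by one).\<close>
definition spins :: "nat \<Rightarrow> (nat \<Rightarrow> real) set" where
  "spins N = PiE {..<N} (\<lambda>_. {-1, 1})"

text \<open>Partition function for a given list of (bond) pairs E and list of field sites K:
  sum over sigma of exp(beta * sum over bonds sigma_i sigma_j + beta * sum over K of sigma_k).
  With K = [] this is Z_N = sum exp(-beta H_N).\<close>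
definition Zpart :: "nat \<Rightarrow> real \<Rightarrow> (nat \<times> nat) list \<Rightarrow> nat list \<Rightarrow> real" where
  "Zpart N \<beta> E K = (\<Sum>\<sigma>\<in>spins N.
      exp (\<beta> * (\<Sum>(i, j)\<leftarrow>E. \<sigma> i * \<sigma> j) + \<beta> * (\<Sum>k\<leftarrow>K. \<sigma> k)))"

definition poisson_dist :: "real \<Rightarrow> nat pmf" where
  "poisson_dist r = (if r \<le> 0 then return_pmf 0 else poisson_pmf r)"

definition edges_dist :: "nat \<Rightarrow> real \<Rightarrow> (nat \<times> nat) list pmf" where
  "edges_dist N a = poisson_dist (a * real N) \<bind>
     (\<lambda>P. replicate_pmf P (pair_pmf (pmf_of_set {..<N}) (pmf_of_set {..<N})))"

definition field_dist :: "nat \<Rightarrow> real \<Rightarrow> real \<Rightarrow> nat list pmf" where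
  "field_dist N a t = poisson_dist (2 * a * t) \<bind>
     (\<lambda>P. replicate_pmf P (pmf_of_set {..<N}))"

definition pressure :: "nat \<Rightarrow> real \<Rightarrow> real \<Rightarrow> real" where
  "pressure N a \<beta> =
     measure_pmf.expectation (edges_dist N a) (\<lambda>E. ln (Zpart N \<beta> E [])) / real N"

definition cavity :: "nat \<Rightarrow> real \<Rightarrow> real \<Rightarrow> real \<Rightarrow> real" where
  "cavity N a \<beta> t =
     measure_pmf.expectation (pair_pmf (edges_dist N a) (field_dist N a t))
       (\<lambda>(E, K). ln (Zpart N \<beta> E K / Zpart N \<beta> E []))"

end

(*
  A system on N + 1 sites splits into a system on the first N sites at connectivity
  N/(N+1) a, a field on these sites created by the bonds to the last one (after gauging away the
  spin of the last site), and Poisson(a/(N+1)) many loops at the last site: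
    (N+1) A_{N+1}(a) - N A_N(N/(N+1) a) = ln 2 + Psi_N + beta a/(N+1).
  The remaining term N (A_N(a) - A_N(N/(N+1) a)) is N a/(N+1) times a difference quotient of A_N over the
  vanishing step a/(N+1).  By Griffiths' second inequality, adding a bond has an increasing effect
  on ln Z, so A_N is convex in a, and convexity makes these quotients converge to A'(a).  Thus the
  increments of N A_N(a) converge, and their limit must be A(a).
*)
theory Submission
  imports Defs "HOL-Real_Asymp.Real_Asymp"
begin

subsection \<open>Poisson lists\<close>

text \<open>Two points shape the proof. Pointwise convergence of A_N and differentiability of A at
  \<alpha> alone say nothing about difference quotients of A_N over a step of order 1/N: an error
  o(1) in A_N is magnified by a factor N. Convexity in the connectivity closes this gap, and it is
  inherited from a discrete statement: with exactly n uniform bonds, the mean of ln Z has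
  nonnegative second differences in n. The recursion between N and N + 1 sites, on the other hand,
  is exact at finite volume. A Poisson number of independent uniform bonds splits into independent
  Poisson families, and each of the (N + 1)^2 ordered pairs carries the rate a/(N + 1). Counting N^2
  old pairs, 2N pairs joining the last site to an old one and a single loop gives the rates N
  (N/(N+1) a), 2 N/(N+1) a and a/(N + 1). Hence the same number N/(N+1) a is the connectivity of the
  smaller system and half the rate of its field at t = 1.\<close>

definition poisson_list :: "real \<Rightarrow> 'a pmf \<Rightarrow> 'a list pmf" where
  "poisson_list r D = poisson_pmf r \<bind> (\<lambda>n. replicate_pmf n D)"

lemma replicate_pmf_Suc_map:
  "replicate_pmf (Suc n) D = map_pmf (\<lambda>(x, xs). x # xs) (pair_pmf D (replicate_pmf n D))"
  by (simp add: pair_pmf_def map_bind_pmf map_pmf_def bind_assoc_pmf bind_return_pmf)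

lemma pmf_replicate_pmf:
  "pmf (replicate_pmf n D) xs = (if length xs = n then prod_list (map (pmf D) xs) else 0)"
proof (induction n arbitrary: xs)
  case 0
  then show ?case by (auto simp: indicator_def)
next
  case (Suc n)
  show ?case
  proof (cases xs)
    case Nil
    have "[] \<notin> set_pmf (replicate_pmf (Suc n) D)"
      unfolding set_replicate_pmf by simp
    then show ?thesis using Nil by (simp add: set_pmf_iff del: replicate_pmf.simps)
  next
    case (Cons y ys)
    have "inj (\<lambda>(x, xs). x # xs)" by (auto simp: inj_def)
    from pmf_map_inj'[OF this, of "pair_pmf D (replicate_pmf n D)" "(y, ys)"]
    have "pmf (replicate_pmf (Suc n) D) (y # ys) = pmf D y * pmf (replicate_pmf n D) ys"
      unfolding replicate_pmf_Suc_map by (simp add: pmf_pair)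
    then show ?thesis using Cons Suc by (simp del: replicate_pmf.simps)
  qed
qed

text \<open>Lists of different lengths come from different components, so a single term of the
  mixture survives. With this explicit weight, thinning becomes an identity between
  products.\<close>

lemma pmf_poisson_list:
  assumes "r > 0"
  shows "pmf (poisson_list r D) xs =
           r ^ length xs / fact (length xs) * exp (- r) * prod_list (map (pmf D) xs)"
  unfolding poisson_list_def pmf_bind using assms
  by (subst integral_measure_pmf_real[where A = "{length xs}"])
     (auto simp: pmf_replicate_pmf split: if_splits)

lemma set_pmf_poisson_list: "r > 0 \<Longrightarrow> set_pmf (poisson_list r D) = lists (set_pmf D)"
  by (auto simp: poisson_list_def set_replicate_pmf)

lemma map_replicate_pmf: "map_pmf (map f) (replicate_pmf n D) = replicate_pmf n (map_pmf f D)"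
proof (induction n)
  case (Suc n)
  show ?case
    by (simp add: Suc[symmetric] map_bind_pmf bind_map_pmf)
qed simp

lemma map_poisson_list: "map_pmf (map f) (poisson_list r D) = poisson_list r (map_pmf f D)"
  by (simp add: poisson_list_def map_bind_pmf map_replicate_pmf)

lemma map_length_poisson_list: "map_pmf length (poisson_list r D) = poisson_pmf r"
proof -
  have "map_pmf length (replicate_pmf n D) = return_pmf n" for n
  proof -
    have "map_pmf length (replicate_pmf n D) = map_pmf (\<lambda>_. n) (replicate_pmf n D)"
      by (intro map_pmf_cong refl) (auto simp: set_replicate_pmf)
    then show ?thesis by simp
  qed
  then show ?thesis by (simp add: poisson_list_def map_bind_pmf bind_return_pmf')
qed

lemma prod_list_const:
  assumes "\<And>x. x \<in> set xs \<Longrightarrow> f x = c"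
  shows "prod_list (map f xs) = (c :: 'b :: comm_monoid_mult) ^ length xs"
  using assms by (induction xs) auto

text \<open>Each pair of lists arises from its \<open>shuffles\<close>, whose number is a binomial
  coefficient; this turns the Poisson weight of the total length into a product.\<close>
lemma partition_poisson_list:
  assumes r: "r > 0" and fin: "finite S"
    and A: "A = {x \<in> S. P x}" "A \<noteq> {}" and B: "B = {x \<in> S. \<not> P x}" "B \<noteq> {}"
  shows "map_pmf (partition P) (poisson_list r (pmf_of_set S)) =
    pair_pmf (poisson_list (r * card A / card S) (pmf_of_set A))
             (poisson_list (r * card B / card S) (pmf_of_set B))"
proof (rule pmf_eqI, safe)
  fix xs ys
  have SAB: "S = A \<union> B" "A \<inter> B = {}" using A B by auto
  have S: "S \<noteq> {}" using A by auto
  have finAB: "finite A" "finite B" using fin A B by auto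
  have cA: "card A > 0" and cB: "card B > 0" and cS: "card S > 0" 
    using finAB A(2) B(2) fin S by (simp_all add: card_gt_0_iff)
  have cSum: "card S = card A + card B" using SAB finAB by (simp add: card_Un_disjoint)
  \<comment> \<open>A uniform point of \<open>S\<close> falls into \<open>A\<close> with probability
    \<open>card A / card S\<close>, which thins the rate. The two rates add up to \<open>r\<close>,
    which is what splits \<open>exp (- r)\<close> below.\<close>
  let ?rA = "r * card A / card S" and ?rB = "r * card B / card S"
  have rA: "?rA > 0" and rB: "?rB > 0" using r cA cB cS by auto
  have "?rA + ?rB = r * card S / card S" by (simp add: cSum distrib_left add_divide_distrib)
  then have rsum: "?rA + ?rB = r" using cS by simp
  show "pmf (map_pmf (partition P) (poisson_list r (pmf_of_set S))) (xs, ys) =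
    pmf (pair_pmf (poisson_list ?rA (pmf_of_set A)) (poisson_list ?rB (pmf_of_set B))) (xs, ys)"
  proof (cases "set xs \<subseteq> A \<and> set ys \<subseteq> B")
    case True
    let ?n = "length xs" and ?m = "length ys"
    have *: "pmf (poisson_list r (pmf_of_set S)) zs
        = (r / card S) ^ (?n + ?m) / fact (?n + ?m) * exp (- r)" if "zs \<in> shuffles xs ys" for zs
    proof -
      have "set zs \<subseteq> S" "length zs = ?n + ?m"
        using set_shuffles[OF that] length_shuffles[OF that] True SAB by auto
      then have "prod_list (map (pmf (pmf_of_set S)) zs) = (1 / card S) ^ (?n + ?m)"
        using fin S prod_list_const[of zs "pmf (pmf_of_set S)" "1 / card S"]
        by (auto simp: subset_iff)
      with \<open>length zs = ?n + ?m\<close> show ?thesis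
        using r by (simp add: pmf_poisson_list power_divide)
    qed
    \<comment> \<open>Only over disjoint alphabets are all interleavings distinct, so that their
      number is the full binomial coefficient; its numerator cancels the factorial in the Poisson
      weight.\<close>
    have "set xs \<inter> set ys = {}" using True SAB by auto
    then have card: "real (card (shuffles xs ys)) = fact (?n + ?m) / (fact ?n * fact ?m)"
      by (simp add: card_disjoint_shuffles binomial_fact)
    have "pmf (map_pmf (partition P) (poisson_list r (pmf_of_set S))) (xs, ys)
      = measure (poisson_list r (pmf_of_set S)) (shuffles xs ys)"
      unfolding pmf_map using True A B by (subst inv_image_partition) auto
    also have "\<dots> = card (shuffles xs ys) * ((r / card S) ^ (?n + ?m) / fact (?n + ?m) * exp (- r))"
      by (subst measure_measure_pmf_finite) (auto simp: *)
    also have "\<dots> = (r / card S) ^ ?n / fact ?n * ((r / card S) ^ ?m / fact ?m) * exp (- r)"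
      unfolding card by (simp add: power_add)
    also have "\<dots> = (r / card S) ^ ?n / fact ?n * exp (- ?rA) * ((r / card S) ^ ?m / fact ?m * exp (- ?rB))"
    proof -
      have "exp (- r) = exp (- ?rA) * exp (- ?rB)"
        using rsum by (simp flip: exp_add)
      then show ?thesis by (simp only: mult_ac)
    qed
    also have "(r / card S) ^ ?n = ?rA ^ ?n * prod_list (map (pmf (pmf_of_set A)) xs)"
    proof -
      have "prod_list (map (pmf (pmf_of_set A)) xs) = (1 / card A) ^ ?n"
        using True finAB A(2) by (intro prod_list_const) auto
      then show ?thesis using cA by (simp flip: power_mult_distrib)
    qed
    also have "(r / card S) ^ ?m = ?rB ^ ?m * prod_list (map (pmf (pmf_of_set B)) ys)"
    proof -
      have "prod_list (map (pmf (pmf_of_set B)) ys) = (1 / card B) ^ ?m"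
        using True finAB B(2) by (intro prod_list_const) auto
      then show ?thesis using cB by (simp flip: power_mult_distrib)
    qed
    finally show ?thesis
      using rA rB by (simp add: pmf_pair pmf_poisson_list mult_ac del: partition_filter_conv)
  next
    case False
    have "(xs, ys) \<notin> set_pmf (map_pmf (partition P) (poisson_list r (pmf_of_set S)))"
      using False A B r fin S by (auto simp: set_pmf_poisson_list subset_iff)
    moreover have "(xs, ys) \<notin> set_pmf (pair_pmf (poisson_list ?rA (pmf_of_set A)) (poisson_list ?rB (pmf_of_set B)))"
      using False rA rB finAB A(2) B(2) by (auto simp: set_pmf_poisson_list)
    ultimately show ?thesis by (simp only: set_pmf_iff not_not)
  qed
qed

section \<open>Poisson expectations as power series in the rate\<close>

lemma summable_linear_exp:
  fixes y :: real
  shows "summable (\<lambda>n. (a + b * real n) * y ^ n / fact n)"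
proof -
  have 1: "summable (\<lambda>n. y ^ n / fact n)"
    using summable_exp[of y] by (simp add: field_simps)
  have "summable (\<lambda>n. real (Suc n) * y ^ Suc n / fact (Suc n))"
    using summable_mult[OF 1, of y] by (simp add: field_simps del: of_nat_Suc)
  then have 2: "summable (\<lambda>n. real n * y ^ n / fact n)"
    by (subst (asm) summable_Suc_iff)
  show ?thesis
    using summable_add[OF summable_mult[OF 1, of a] summable_mult[OF 2, of b]]
    by (simp add: algebra_simps add_divide_distrib)
qed

text \<open>Linear growth is the natural class here: ln Z grows at most linearly in the number of
  bonds, and the class is closed under taking differences, hence under the two differentiations in
  the rate made below.\<close>

lemma summable_linear_growth:
  fixes g :: "nat \<Rightarrow> real"
  assumes g: "\<And>n. \<bar>g n\<bar> \<le> a + b * real n"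
  shows "summable (\<lambda>n. \<bar>g n / fact n * y ^ n\<bar>)"
proof (rule summable_comparison_test')
  show "summable (\<lambda>n. (a + b * real n) * \<bar>y\<bar> ^ n / fact n)" by (rule summable_linear_exp)
  show "norm \<bar>g n / fact n * y ^ n\<bar> \<le> (a + b * real n) * \<bar>y\<bar> ^ n / fact n" for n
    using mult_right_mono[OF g[of n], of "\<bar>y\<bar> ^ n / fact n"]
    by (simp add: abs_mult power_abs)
qed

text \<open>The series is entire in \<open>r\<close>, so questions about the dependence on the rate
  become calculus with power series.\<close>

lemma
  fixes g :: "nat \<Rightarrow> real"
  assumes r: "r > 0" and g: "\<And>n. \<bar>g n\<bar> \<le> a + b * real n"
  shows integrable_poisson: "integrable (poisson_pmf r) g"
    and expectation_poisson:
      "measure_pmf.expectation (poisson_pmf r) g = exp (- r) * (\<Sum>n. g n / fact n * r ^ n)"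
proof -
  let ?h = "\<lambda>n. exp (- r) * (g n / fact n * r ^ n)"
  have sm: "summable (\<lambda>n. \<bar>g n / fact n * r ^ n\<bar>)" by (rule summable_linear_growth[OF g])
  have h: "pmf (poisson_pmf r) n *\<^sub>R g n = ?h n" for n
    using r by simp
  have i: "integrable (count_space UNIV) ?h"
    unfolding integrable_count_space_nat_iff using summable_mult[OF sm, of "exp (-r)"]
    by (simp add: abs_mult)
  then show "integrable (poisson_pmf r) g"
    unfolding measure_pmf_eq_density
    by (subst integrable_density) (auto simp: h simp del: pmf_poisson real_scaleR_def)
  have "measure_pmf.expectation (poisson_pmf r) g = integral\<^sup>L (count_space UNIV) ?h"
    unfolding measure_pmf_eq_density
    by (subst integral_density) (auto simp: h simp del: pmf_poisson real_scaleR_def)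
  also have "\<dots> = (\<Sum>n. ?h n)" using i by (rule integral_count_space_nat)
  also have "\<dots> = exp (- r) * (\<Sum>n. g n / fact n * r ^ n)"
    by (rule suminf_mult[OF summable_rabs_cancel[OF sm]])
  finally show "measure_pmf.expectation (poisson_pmf r) g = exp (- r) * (\<Sum>n. g n / fact n * r ^ n)" .
qed

lemma expectation_poisson_id:
  assumes "r > 0"
  shows "measure_pmf.expectation (poisson_pmf r) real = r"
proof -
  have "(\<lambda>n. r * (r ^ n / fact n)) sums (r * exp r)"
    using sums_mult[OF exp_converges[of r], of r] by (simp add: field_simps)
  then have "(\<lambda>n. real (Suc n) / fact (Suc n) * r ^ Suc n) sums (r * exp r)"
    by (simp add: field_simps del: of_nat_Suc)
  then have "(\<lambda>n. real n / fact n * r ^ n) sums (r * exp r)"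
    by (subst (asm) sums_Suc_iff) simp
  then show ?thesis
    using assms by (subst expectation_poisson[of r real 0 1]) 
      (auto simp: sums_iff exp_minus field_simps)
qed

text \<open>Differentiating the series shifts \<open>g\<close> by one, differentiating
  \<open>exp (- r)\<close> subtracts \<open>g\<close>. For a positive rate the derivative is thus
  the expected effect of one additional point.\<close>

lemma poisson_series_has_derivative:
  fixes g :: "nat \<Rightarrow> real"
  assumes g: "\<And>n. \<bar>g n\<bar> \<le> a + b * real n"
  shows "((\<lambda>r. exp (- r) * (\<Sum>n. g n / fact n * r ^ n)) has_real_derivative
           exp (- r) * (\<Sum>n. (g (Suc n) - g n) / fact n * r ^ n)) (at r)"
proof -
  have s: "summable (\<lambda>n. g n / fact n * y ^ n)" for y
    by (rule summable_rabs_cancel[OF summable_linear_growth[OF g]])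
  have g': "\<bar>g (Suc n)\<bar> \<le> (a + b) + b * real n" for n
    using g[of "Suc n"] by (simp add: algebra_simps)
  have s': "summable (\<lambda>n. g (Suc n) / fact n * y ^ n)" for y
    by (rule summable_rabs_cancel[OF summable_linear_growth[OF g']])
  have d: "diffs (\<lambda>n. g n / fact n) = (\<lambda>n. g (Suc n) / fact n)"
    by (auto simp: diffs_def fun_eq_iff field_simps simp del: of_nat_Suc)
  have D: "((\<lambda>r. \<Sum>n. g n / fact n * r ^ n) has_real_derivative
       (\<Sum>n. g (Suc n) / fact n * r ^ n)) (at r)"
    using termdiffs_strong_converges_everywhere[OF s, of r] unfolding d .
  have "(\<Sum>n. (g (Suc n) - g n) / fact n * r ^ n) =
     (\<Sum>n. g (Suc n) / fact n * r ^ n) - (\<Sum>n. g n / fact n * r ^ n)"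
    by (subst suminf_diff[OF s' s]) (simp add: algebra_simps diff_divide_distrib)
  moreover have "((\<lambda>r. exp (- r) * (\<Sum>n. g n / fact n * r ^ n)) has_real_derivative
      - exp (- r) * (\<Sum>n. g n / fact n * r ^ n) + (\<Sum>n. g (Suc n) / fact n * r ^ n) * exp (- r)) (at r)"
    by (rule DERIV_mult[OF _ D]) (auto intro!: derivative_eq_intros)
  ultimately show ?thesis by (simp only: right_diff_distrib) (simp add: mult.commute)
qed

lemma convex_on_cong:
  assumes "convex_on I f" "\<And>x. x \<in> I \<Longrightarrow> f x = g x"
  shows "convex_on I g"
proof (rule convex_onI)
  show "convex I" using assms(1) by (simp add: convex_on_def)
  then show "g ((1 - t) *\<^sub>R x + t *\<^sub>R y) \<le> (1 - t) * g x + t * g y"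
    if "0 < t" "t < 1" "x \<in> I" "y \<in> I" for t x y
    using convex_onD[OF assms(1), of t x y] that convexD[of I x y "1 - t" t] assms(2) by simp
qed

text \<open>The second derivative in \<open>r\<close> is the expectation of the second difference of \<open>g\<close>.\<close>
lemma convex_on_expectation_poisson:
  fixes g :: "nat \<Rightarrow> real"
  assumes g: "\<And>n. \<bar>g n\<bar> \<le> a + b * real n"
    and conv: "\<And>n. 2 * g (Suc n) \<le> g n + g (Suc (Suc n))"
  shows "convex_on {0<..} (\<lambda>r. measure_pmf.expectation (poisson_pmf r) g)"
proof -
  let ?d = "\<lambda>n. g (Suc n) - g n"
  have gd: "\<bar>?d n\<bar> \<le> (2 * a + b) + (2 * b) * real n" for n
    using g[of n] g[of "Suc n"] by (simp add: algebra_simps)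
  have gdd: "\<bar>?d (Suc n) - ?d n\<bar> \<le> (2 * (2 * a + b) + 2 * b) + (4 * b) * real n" for n
    using gd[of n] gd[of "Suc n"] by (simp add: algebra_simps)
  have "convex_on {0<..} (\<lambda>r. exp (- r) * (\<Sum>n. g n / fact n * r ^ n))"
  proof (rule f''_ge0_imp_convex)
    fix r :: real assume r: "r \<in> {0<..}"
    show "((\<lambda>r. exp (- r) * (\<Sum>n. g n / fact n * r ^ n)) has_real_derivative
           exp (- r) * (\<Sum>n. ?d n / fact n * r ^ n)) (at r)"
      by (rule poisson_series_has_derivative[OF g])
    show "((\<lambda>r. exp (- r) * (\<Sum>n. ?d n / fact n * r ^ n)) has_real_derivative
           exp (- r) * (\<Sum>n. (?d (Suc n) - ?d n) / fact n * r ^ n)) (at r)"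
      by (rule poisson_series_has_derivative[OF gd])
    have "?d (Suc n) - ?d n \<ge> 0" for n using conv[of n] by simp
    then show "exp (- r) * (\<Sum>n. (?d (Suc n) - ?d n) / fact n * r ^ n) \<ge> 0"
      using r summable_rabs_cancel[OF summable_linear_growth[OF gdd, of r]]
      by (intro mult_nonneg_nonneg suminf_nonneg) auto
  qed auto
  moreover have "measure_pmf.expectation (poisson_pmf r) g = exp (- r) * (\<Sum>n. g n / fact n * r ^ n)"
    if "r \<in> {0<..}" for r
    using that by (intro expectation_poisson[OF _ g]) auto
  ultimately show ?thesis
    by (metis (lifting) convex_on_cong)
qed

text \<open>The dominating function depends on the length alone, whose law is Poisson. The bound is
  asked for on the support only, because the bounds on \<open>ln (Zpart N \<beta> E K)\<close>
  require the sites to lie below \<open>N\<close>.\<close>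

lemma integrable_poisson_list:
  fixes f :: "'a list \<Rightarrow> real"
  assumes "r > 0" "\<And>xs. xs \<in> set_pmf (poisson_list r D) \<Longrightarrow> \<bar>f xs\<bar> \<le> a + b * real (length xs)"
  shows "integrable (poisson_list r D) f"
proof (rule Bochner_Integration.integrable_bound)
  have "integrable (map_pmf length (poisson_list r D)) (\<lambda>n. a + b * real n)"
    unfolding map_length_poisson_list
    using integrable_poisson[of r real 0 1] assms by auto
  then show "integrable (poisson_list r D) (\<lambda>xs. a + b * real (length xs))" by simp
  show "AE x in measure_pmf (poisson_list r D). norm (f x) \<le> norm (a + b * real (length x))"
    using assms by (fastforce simp: AE_measure_pmf_iff)
qed auto

text \<open>This is conditioning on the number of points. Nonnegativity allows the exchange to be
  made for the nonnegative integral; given the length, the support is finite, so the inner integrals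
  are finite.\<close>

lemma expectation_poisson_list:
  fixes f :: "'a list \<Rightarrow> real"
  assumes r: "r > 0" and fin: "finite (set_pmf D)" and int: "integrable (poisson_list r D) f"
    and f: "\<And>xs. set xs \<subseteq> set_pmf D \<Longrightarrow> f xs \<ge> 0"
  shows "measure_pmf.expectation (poisson_list r D) f =
         measure_pmf.expectation (poisson_pmf r) (\<lambda>n. measure_pmf.expectation (replicate_pmf n D) f)"
proof -
  have fin': "finite (set_pmf (replicate_pmf n D))" for n
    using finite_lists_length_eq[OF fin, of n]
    by (rule finite_subset[rotated]) (auto simp: set_replicate_pmf)
  have f': "AE xs in replicate_pmf n D. 0 \<le> f xs" for n
    by (auto simp: AE_measure_pmf_iff set_replicate_pmf intro!: f)
  have f'': "AE xs in poisson_list r D. 0 \<le> f xs"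
    using r by (auto simp: AE_measure_pmf_iff set_pmf_poisson_list intro!: f)
  let ?g = "\<lambda>n. measure_pmf.expectation (replicate_pmf n D) f"
  have "(\<integral>\<^sup>+x. f x \<partial>poisson_list r D) = (\<integral>\<^sup>+n. \<integral>\<^sup>+x. f x \<partial>replicate_pmf n D \<partial>poisson_pmf r)"
    unfolding poisson_list_def by simp
  also have "\<dots> = (\<integral>\<^sup>+n. ?g n \<partial>poisson_pmf r)"
    by (intro nn_integral_cong nn_integral_eq_integral integrable_measure_pmf_finite fin' f')
  finally have "(\<integral>\<^sup>+x. f x \<partial>poisson_list r D) = (\<integral>\<^sup>+n. ?g n \<partial>poisson_pmf r)" .
  moreover have "?g n \<ge> 0" for n using f' by (rule integral_nonneg_AE)
  ultimately show ?thesis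
    using f'' by (simp add: integral_eq_nn_integral)
qed

subsection \<open>Griffiths inequalities\<close>

lemma finite_spins [simp]: "finite (spins N)"
  by (simp add: spins_def finite_PiE)

lemma spins_values: "\<sigma> \<in> spins N \<Longrightarrow> i < N \<Longrightarrow> \<sigma> i = -1 \<or> \<sigma> i = 1"
  by (auto simp: spins_def PiE_iff)

lemma card_spins: "card (spins N) = 2 ^ N"
  by (simp add: spins_def card_PiE flip: numeral_2_eq_2)

lemma const_in_spins: "(\<lambda>i\<in>{..<N}. 1) \<in> spins N"
  by (auto simp: spins_def)

text \<open>Spins square to one, so the map is its own inverse. The change of variables serves both
  the duplicated replicas in Griffiths' second inequality and the gauge transformation at the last
  site.\<close>

lemma spins_mult_bij:
  assumes "\<sigma> \<in> spins N"
  shows "bij_betw (\<lambda>\<rho>. \<lambda>i\<in>{..<N}. \<rho> i * \<sigma> i) (spins N) (spins N)"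
proof -
  let ?m = "\<lambda>\<rho>. \<lambda>i\<in>{..<N}. \<rho> i * \<sigma> i"
  have sq: "\<sigma> i * \<sigma> i = 1" if "i < N" for i using spins_values[OF assms that] by auto
  have m: "?m \<in> spins N \<rightarrow> spins N"
  proof
    fix \<rho> assume "\<rho> \<in> spins N"
    then have "\<rho> i * \<sigma> i \<in> {-1, 1}" if "i < N" for i
      using spins_values[OF assms that] spins_values[of \<rho> N i] that by auto
    then show "?m \<rho> \<in> spins N" by (auto simp: spins_def)
  qed
  have inv: "?m (?m \<rho>) = \<rho>" if "\<rho> \<in> spins N" for \<rho>
    using that sq by (auto simp: fun_eq_iff spins_def PiE_iff extensional_def mult.assoc)
  show ?thesis by (rule bij_betwI[where g = ?m]) (rule m, rule m, erule inv, erule inv)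
qed

lemma sum_spins_mult:
  assumes "\<sigma> \<in> spins N"
  shows "(\<Sum>\<tau>\<in>spins N. h \<tau>) = (\<Sum>\<rho>\<in>spins N. h (\<lambda>i\<in>{..<N}. \<rho> i * \<sigma> i))"
  by (rule sum.reindex_bij_betw[OF spins_mult_bij[OF assms], symmetric])

text \<open>The sum factorises over the sites; a site contributes 2 or 0 according to whether it
  occurs in \<open>L\<close> an even or an odd number of times.\<close>

lemma sum_spins_monomial_nonneg:
  assumes "set L \<subseteq> {..<N}"
  shows "0 \<le> (\<Sum>\<sigma>\<in>spins N. \<Prod>k\<leftarrow>L. \<sigma> k)"
proof -
  have "(\<Prod>k\<leftarrow>L. \<sigma> k) = (\<Prod>k<N. \<sigma> k ^ count_list L k)" for \<sigma> :: "nat \<Rightarrow> real"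
    using assms
  proof (induction L)
    case (Cons a L)
    have "(\<Prod>k<N. \<sigma> k ^ count_list (a # L) k)
        = (\<Prod>k<N. (if k = a then \<sigma> k else 1) * \<sigma> k ^ count_list L k)"
      by (intro prod.cong) auto
    also have "\<dots> = \<sigma> a * (\<Prod>k<N. \<sigma> k ^ count_list L k)"
      using Cons.prems by (simp add: prod.distrib prod.delta')
    finally show ?case using Cons by simp
  qed simp
  then have "(\<Sum>\<sigma>\<in>spins N. \<Prod>k\<leftarrow>L. \<sigma> k) = (\<Sum>\<sigma>\<in>spins N. \<Prod>k<N. \<sigma> k ^ count_list L k)"
    by simp
  also have "\<dots> = (\<Prod>k<N. \<Sum>s\<in>{-1, 1}. s ^ count_list L k)"
    unfolding spins_def by (rule prod_sum_PiE[symmetric]) auto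
  also have "\<dots> \<ge> 0"
  proof (rule prod_nonneg, safe)
    fix k show "0 \<le> (\<Sum>s\<in>{-1, 1::real}. s ^ count_list L k)"
      by (cases "even (count_list L k)") auto
  qed
  finally show ?thesis .
qed

lemma exp_mult_sign: "s = -1 \<or> s = 1 \<Longrightarrow> exp (J * s) = cosh J + sinh J * (s :: real)"
  using cosh_plus_sinh[of J] cosh_minus_sinh[of J] by auto

text \<open>Expanding each bond as cosh J + sinh J times its spin product leaves a nonnegative
  combination of monomial sums. The monomial \<open>L\<close> must vary in the induction, since the
  sinh term appends the ends of the bond to it. Couplings vary with the bond because the duplicated
  system has couplings depending on \<rho>.\<close>

lemma griffiths_first:
  assumes "set L \<subseteq> {..<N}" "set E \<subseteq> {..<N} \<times> {..<N}" "\<And>e. e \<in> set E \<Longrightarrow> 0 \<le> J e"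
  shows "0 \<le> (\<Sum>\<sigma>\<in>spins N. (\<Prod>k\<leftarrow>L. \<sigma> k) * exp (\<Sum>(i, j)\<leftarrow>E. J (i, j) * (\<sigma> i * \<sigma> j)))"
  using assms
proof (induction E arbitrary: L)
  case Nil
  then show ?case using sum_spins_monomial_nonneg by simp
next
  case (Cons e E)
  obtain i j where e: "e = (i, j)" by force
  have ij: "i < N" "j < N" using Cons.prems(2) e by auto
  let ?J = "J (i, j)" and ?X = "\<lambda>\<sigma>. exp (\<Sum>(i, j)\<leftarrow>E. J (i, j) * (\<sigma> i * \<sigma> j))"
  have J: "?J \<ge> 0" using Cons.prems(3) e by simp
  have "(\<Prod>k\<leftarrow>L. \<sigma> k) * exp (\<Sum>(i, j)\<leftarrow>e # E. J (i, j) * (\<sigma> i * \<sigma> j)) =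
     cosh ?J * ((\<Prod>k\<leftarrow>L. \<sigma> k) * ?X \<sigma>) + sinh ?J * ((\<Prod>k\<leftarrow>i # j # L. \<sigma> k) * ?X \<sigma>)"
    if "\<sigma> \<in> spins N" for \<sigma>
  proof -
    have "\<sigma> i * \<sigma> j = -1 \<or> \<sigma> i * \<sigma> j = 1"
      using spins_values[OF that ij(1)] spins_values[OF that ij(2)] by auto
    then have "exp (?J * (\<sigma> i * \<sigma> j)) = cosh ?J + sinh ?J * (\<sigma> i * \<sigma> j)"
      by (rule exp_mult_sign)
    then show ?thesis
      by (simp only: e exp_add list.map sum_list.Cons prod_list.Cons split_conv)
         (simp only: ring_distribs mult_ac)
  qed
  then have "(\<Sum>\<sigma>\<in>spins N. (\<Prod>k\<leftarrow>L. \<sigma> k) * exp (\<Sum>(i, j)\<leftarrow>e # E. J (i, j) * (\<sigma> i * \<sigma> j))) =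
    cosh ?J * (\<Sum>\<sigma>\<in>spins N. (\<Prod>k\<leftarrow>L. \<sigma> k) * ?X \<sigma>) +
    sinh ?J * (\<Sum>\<sigma>\<in>spins N. (\<Prod>k\<leftarrow>i # j # L. \<sigma> k) * ?X \<sigma>)"
    by (simp add: sum.distrib sum_distrib_left)
  moreover have "0 \<le> (\<Sum>\<sigma>\<in>spins N. (\<Prod>k\<leftarrow>L. \<sigma> k) * ?X \<sigma>)"
    "0 \<le> (\<Sum>\<sigma>\<in>spins N. (\<Prod>k\<leftarrow>i # j # L. \<sigma> k) * ?X \<sigma>)"
    using Cons.prems ij by (intro Cons.IH; simp)+
  ultimately show ?case using J by simp
qed

text \<open>Ginibre's duplication: with \<open>\<tau> = \<rho> \<sigma>\<close> the pair of
  replicas is a ferromagnet for \<open>\<sigma>\<close> with couplings \<open>\<beta> (1 + \<rho> i * \<rho> j) \<ge> 0\<close>.\<close>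
lemma griffiths_second:
  fixes \<beta> :: real
  assumes \<beta>: "\<beta> \<ge> 0" and E: "set E \<subseteq> {..<N} \<times> {..<N}" and a: "a1 < N" "a2 < N" and b: "b1 < N" "b2 < N"
  defines "w \<equiv> \<lambda>\<sigma>. exp (\<beta> * (\<Sum>(i, j)\<leftarrow>E. \<sigma> i * \<sigma> j))"
  shows "(\<Sum>\<sigma>\<in>spins N. w \<sigma> * (\<sigma> a1 * \<sigma> a2)) * (\<Sum>\<sigma>\<in>spins N. w \<sigma> * (\<sigma> b1 * \<sigma> b2))
    \<le> (\<Sum>\<sigma>\<in>spins N. w \<sigma>) * (\<Sum>\<sigma>\<in>spins N. w \<sigma> * (\<sigma> a1 * \<sigma> a2 * (\<sigma> b1 * \<sigma> b2)))"
proof -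
  let ?S = "spins N"
  let ?F = "\<lambda>\<sigma> \<tau>. w \<sigma> * w \<tau> * (\<sigma> a1 * \<sigma> a2 * (\<sigma> b1 * \<sigma> b2) - \<sigma> a1 * \<sigma> a2 * (\<tau> b1 * \<tau> b2))"
  let ?X = "\<lambda>\<rho> \<sigma>. exp (\<Sum>(i, j)\<leftarrow>E. (\<beta> * (1 + \<rho> i * \<rho> j)) * (\<sigma> i * \<sigma> j))"
  have w: "w \<sigma> * w (\<lambda>i\<in>{..<N}. \<rho> i * \<sigma> i) = ?X \<rho> \<sigma>" for \<rho> \<sigma>
  proof -
    have "\<beta> * (\<Sum>(i, j)\<leftarrow>E. \<sigma> i * \<sigma> j) + \<beta> * (\<Sum>(i, j)\<leftarrow>E. (\<lambda>i\<in>{..<N}. \<rho> i * \<sigma> i) i * (\<lambda>i\<in>{..<N}. \<rho> i * \<sigma> i) j)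
       = (\<Sum>(i, j)\<leftarrow>E. (\<beta> * (1 + \<rho> i * \<rho> j)) * (\<sigma> i * \<sigma> j))"
      using E by (induction E) (auto simp: algebra_simps)
    then show ?thesis unfolding w_def by (simp flip: exp_add)
  qed
  have "(\<Sum>\<sigma>\<in>?S. w \<sigma>) * (\<Sum>\<sigma>\<in>?S. w \<sigma> * (\<sigma> a1 * \<sigma> a2 * (\<sigma> b1 * \<sigma> b2)))
      - (\<Sum>\<sigma>\<in>?S. w \<sigma> * (\<sigma> a1 * \<sigma> a2)) * (\<Sum>\<sigma>\<in>?S. w \<sigma> * (\<sigma> b1 * \<sigma> b2))
    = (\<Sum>\<sigma>\<in>?S. \<Sum>\<tau>\<in>?S. ?F \<sigma> \<tau>)"
    unfolding mult.commute[of "\<Sum>\<sigma>\<in>?S. w \<sigma>"]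
    by (simp only: sum_product sum_subtractf[symmetric]) (simp add: algebra_simps)
  also have "\<dots> = (\<Sum>\<sigma>\<in>?S. \<Sum>\<rho>\<in>?S. ?F \<sigma> (\<lambda>i\<in>{..<N}. \<rho> i * \<sigma> i))"
    by (intro sum.cong refl sum_spins_mult)
  \<comment> \<open>After the substitution the difference of the \<open>b\<close> terms is the
    \<sigma> monomial times \<open>1 - \<rho> b1 * \<rho> b2\<close>, a nonnegative factor free of
    \<sigma>. For fixed \<rho> the first inequality then applies to the inner sum.\<close>
  also have "\<dots> = (\<Sum>\<sigma>\<in>?S. \<Sum>\<rho>\<in>?S. (1 - \<rho> b1 * \<rho> b2) * ((\<Prod>k\<leftarrow>[a1, a2, b1, b2]. \<sigma> k) * ?X \<rho> \<sigma>))"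
    unfolding w using a b by (simp add: algebra_simps)
  also have "\<dots> = (\<Sum>\<rho>\<in>?S. (1 - \<rho> b1 * \<rho> b2) * (\<Sum>\<sigma>\<in>?S. (\<Prod>k\<leftarrow>[a1, a2, b1, b2]. \<sigma> k) * ?X \<rho> \<sigma>))"
    by (subst sum.swap) (simp add: sum_distrib_left)
  also have "\<dots> \<ge> 0"
  proof (rule sum_nonneg, rule mult_nonneg_nonneg)
    fix \<rho> assume \<rho>: "\<rho> \<in> ?S"
    show "0 \<le> 1 - \<rho> b1 * \<rho> b2"
      using spins_values[OF \<rho> b(1)] spins_values[OF \<rho> b(2)] by auto
    have "0 \<le> \<beta> * (1 + \<rho> i * \<rho> j)" if "(i, j) \<in> set E" for i j
    proof -
      have "i < N" "j < N" using that E by auto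
      then show ?thesis using \<beta> spins_values[OF \<rho>, of i] spins_values[OF \<rho>, of j] by auto
    qed
    then show "0 \<le> (\<Sum>\<sigma>\<in>?S. (\<Prod>k\<leftarrow>[a1, a2, b1, b2]. \<sigma> k) * ?X \<rho> \<sigma>)"
      using griffiths_first[of "[a1, a2, b1, b2]" N E "\<lambda>(i, j). \<beta> * (1 + \<rho> i * \<rho> j)"] a b E
      by (auto simp: split_beta)
  qed
  finally show ?thesis by simp
qed

text \<open>In logarithms: the gain from adding \<open>a\<close> is no smaller after
  \<open>b\<close> has been added. Expanding both bonds with cosh and sinh, everything cancels in
  the difference of the two sides except sinh^2 \<beta> times \<open>Z * Mab - Ma * Mb\<close>,
  whose sign is Griffiths' second inequality.\<close>

lemma Zpart_log_supermodular:
  assumes \<beta>: "\<beta> > 0" and E: "set E \<subseteq> {..<N} \<times> {..<N}"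
    and a: "a \<in> {..<N} \<times> {..<N}" and b: "b \<in> {..<N} \<times> {..<N}"
  shows "Zpart N \<beta> (a # E) [] * Zpart N \<beta> (b # E) [] \<le> Zpart N \<beta> E [] * Zpart N \<beta> (a # b # E) []"
proof -
  obtain a1 a2 b1 b2 where ab: "a = (a1, a2)" "b = (b1, b2)" by (metis surj_pair)
  have l: "a1 < N" "a2 < N" "b1 < N" "b2 < N" using a b ab by auto
  define w where "w = (\<lambda>\<sigma>. exp (\<beta> * (\<Sum>(i, j)\<leftarrow>E. \<sigma> i * \<sigma> j)))"
  define c d where "c = cosh \<beta>" and "d = sinh \<beta>"
  let ?s = "\<lambda>\<sigma>. \<sigma> a1 * \<sigma> a2 :: real" and ?t = "\<lambda>\<sigma>. \<sigma> b1 * \<sigma> b2 :: real"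
  define Z Ma Mb Mab where "Z = (\<Sum>\<sigma>\<in>spins N. w \<sigma>)" and "Ma = (\<Sum>\<sigma>\<in>spins N. w \<sigma> * ?s \<sigma>)"
    and "Mb = (\<Sum>\<sigma>\<in>spins N. w \<sigma> * ?t \<sigma>)" and "Mab = (\<Sum>\<sigma>\<in>spins N. w \<sigma> * (?s \<sigma> * ?t \<sigma>))"
  have ea: "exp (\<beta> * ?s \<sigma>) = c + d * ?s \<sigma>" and eb: "exp (\<beta> * ?t \<sigma>) = c + d * ?t \<sigma>"
    if "\<sigma> \<in> spins N" for \<sigma>
    unfolding c_def d_def using spins_values[OF that] l by (intro exp_mult_sign; fastforce)+
  have 0: "Zpart N \<beta> E [] = Z" by (simp add: Zpart_def Z_def w_def)
  have "Zpart N \<beta> (a # E) [] = (\<Sum>\<sigma>\<in>spins N. w \<sigma> * exp (\<beta> * ?s \<sigma>))"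
    by (simp add: Zpart_def w_def ab exp_add algebra_simps)
  also have "\<dots> = c * Z + d * Ma"
    by (simp add: ea Z_def Ma_def algebra_simps sum.distrib sum_distrib_left)
  finally have 1: "Zpart N \<beta> (a # E) [] = c * Z + d * Ma" .
  have "Zpart N \<beta> (b # E) [] = (\<Sum>\<sigma>\<in>spins N. w \<sigma> * exp (\<beta> * ?t \<sigma>))"
    by (simp add: Zpart_def w_def ab exp_add algebra_simps)
  also have "\<dots> = c * Z + d * Mb"
    by (simp add: eb Z_def Mb_def algebra_simps sum.distrib sum_distrib_left)
  finally have 2: "Zpart N \<beta> (b # E) [] = c * Z + d * Mb" .
  have "Zpart N \<beta> (a # b # E) [] = (\<Sum>\<sigma>\<in>spins N. w \<sigma> * exp (\<beta> * ?s \<sigma>) * exp (\<beta> * ?t \<sigma>))"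
    by (simp add: Zpart_def w_def ab exp_add algebra_simps)
  also have "\<dots> = (\<Sum>\<sigma>\<in>spins N. c * c * w \<sigma> + c * d * (w \<sigma> * ?s \<sigma>) + c * d * (w \<sigma> * ?t \<sigma>)
      + d * d * (w \<sigma> * (?s \<sigma> * ?t \<sigma>)))"
    by (intro sum.cong refl) (simp add: ea eb algebra_simps)
  also have "\<dots> = c * c * Z + c * d * Ma + c * d * Mb + d * d * Mab"
    by (simp add: Z_def Ma_def Mb_def Mab_def sum.distrib sum_distrib_left)
  finally have 3: "Zpart N \<beta> (a # b # E) [] = c * c * Z + c * d * Ma + c * d * Mb + d * d * Mab" .
  have "Ma * Mb \<le> Z * Mab"
    unfolding Z_def Ma_def Mb_def Mab_def w_def using griffiths_second[OF _ E l] \<beta> by simp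
  then have "d * d * (Ma * Mb) \<le> d * d * (Z * Mab)"
    by (intro mult_left_mono) auto
  then show ?thesis unfolding 0 1 2 3 by (simp add: algebra_simps)
qed

section \<open>The partition function: bounds and removal of the last site\<close>

lemma Zpart_pos: "Zpart N \<beta> E K > 0"
  unfolding Zpart_def using const_in_spins[of N] by (intro sum_pos) auto

text \<open>The all-up configuration alone contributes at least 1. For the upper bound, each of the
  \<open>2 ^ N\<close> terms has at most \<beta> per bond and per field site in its
  exponent.\<close>

lemma
  assumes \<beta>: "\<beta> > 0" and E: "set E \<subseteq> {..<N} \<times> {..<N}" and K: "set K \<subseteq> {..<N}"
  shows ln_Zpart_nonneg: "0 \<le> ln (Zpart N \<beta> E K)"
    and ln_Zpart_le: "ln (Zpart N \<beta> E K) \<le> real N * ln 2 + \<beta> * (length E + length K)"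
proof -
  let ?H = "\<lambda>\<sigma>. \<beta> * (\<Sum>(i, j)\<leftarrow>E. \<sigma> i * \<sigma> j) + \<beta> * (\<Sum>k\<leftarrow>K. \<sigma> k)"
  let ?o = "\<lambda>i\<in>{..<N}. 1 :: real"
  have "(\<Sum>(i, j)\<leftarrow>E. ?o i * ?o j) = length E" using E by (induction E) auto
  moreover have "(\<Sum>k\<leftarrow>K. ?o k) = length K" using K by (induction K) auto
  ultimately have "1 \<le> exp (?H ?o)" using \<beta> by simp
  also have "exp (?H ?o) \<le> Zpart N \<beta> E K"
    unfolding Zpart_def by (rule member_le_sum[OF const_in_spins]) auto
  finally show "0 \<le> ln (Zpart N \<beta> E K)" by simp
  have "Zpart N \<beta> E K \<le> (\<Sum>\<sigma>\<in>spins N. exp (\<beta> * (length E + length K)))"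
    unfolding Zpart_def
  proof (intro sum_mono)
    fix \<sigma> assume \<sigma>: "\<sigma> \<in> spins N"
    have le: "\<sigma> i \<le> 1" "\<bar>\<sigma> i\<bar> = 1" if "i < N" for i using spins_values[OF \<sigma> that] by auto
    have "\<sigma> i * \<sigma> j \<le> 1" if "i < N" "j < N" for i j
      using spins_values[OF \<sigma> that(1)] spins_values[OF \<sigma> that(2)] by auto
    then have "(\<Sum>(i, j)\<leftarrow>E. \<sigma> i * \<sigma> j) \<le> length E" using E by (induction E) (auto, smt (verit))
    moreover have "(\<Sum>k\<leftarrow>K. \<sigma> k) \<le> length K" using K le by (induction K) (auto, smt (verit))
    ultimately have "?H \<sigma> \<le> \<beta> * length E + \<beta> * length K"
      using \<beta> by (intro add_mono mult_left_mono) auto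
    then show "exp (?H \<sigma>) \<le> exp (\<beta> * (length E + length K))"
      by (simp add: distrib_left)
  qed
  also have "\<dots> = exp (real N * ln 2 + \<beta> * (length E + length K))"
    by (simp add: card_spins exp_add exp_of_nat_mult)
  finally show "ln (Zpart N \<beta> E K) \<le> real N * ln 2 + \<beta> * (length E + length K)"
    using Zpart_pos[of N \<beta> E K] by (metis exp_gt_zero ln_exp ln_le_cancel_iff)
qed

text \<open>Gauge symmetry: summing over the spin \<open>s\<close> of the new site \<open>N\<close> and replacing \<open>\<sigma>\<close> by
  \<open>s \<sigma>\<close> turns its bonds into a field on the other sites; loops at \<open>N\<close> are constants.\<close>
lemma Zpart_Suc:
  assumes E: "set E \<subseteq> {..<Suc N} \<times> {..<Suc N}"
  defines "bulk \<equiv> (\<lambda>e. e \<in> {..<N} \<times> {..<N})" and "loop \<equiv> (\<lambda>e. e = (N, N))"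
  defines "B \<equiv> filter bulk E" and "R \<equiv> filter (\<lambda>e. \<not> bulk e) E"
  shows "Zpart (Suc N) \<beta> E [] = 2 * exp (\<beta> * length (filter loop R)) *
    Zpart N \<beta> B (map (\<lambda>(i, j). min i j) (filter (\<lambda>e. \<not> loop e) R))"
proof -
  let ?n = "real (length (filter loop R))"
  let ?K = "map (\<lambda>(i, j). min i j) (filter (\<lambda>e. \<not> loop e) R)"
  have B: "set B \<subseteq> {..<N} \<times> {..<N}" by (auto simp: B_def bulk_def)
  have K: "set ?K \<subseteq> {..<N}"
    using E by (fastforce simp: R_def bulk_def loop_def less_Suc_eq)
  \<comment> \<open>A loop at \<open>N\<close> gives \<open>s * s = 1\<close>, a bond with one end
    at \<open>N\<close> gives \<open>s\<close> times the spin at its other end, and an old bond does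
    not see \<open>s\<close>. As \<open>N\<close> is the largest site, \<open>min\<close> picks the
    old end.\<close>
  have energy: "(\<Sum>(i, j)\<leftarrow>E. (\<sigma>(N := s)) i * (\<sigma>(N := s)) j) =
      ?n + (\<Sum>(i, j)\<leftarrow>B. \<sigma> i * \<sigma> j) + s * (\<Sum>k\<leftarrow>?K. \<sigma> k)" if "s = -1 \<or> s = 1" for \<sigma> s
    using E unfolding B_def R_def
  proof (induction E)
    case (Cons e E)
    obtain i j where e: "e = (i, j)" by force
    have ij: "i < Suc N" "j < Suc N" using Cons.prems e by auto
    have ss: "s * s = 1" using that by auto
    show ?case
      using Cons ij ss
      by (cases "i = N"; cases "j = N")
         (simp_all add: e bulk_def loop_def algebra_simps min_def)
  qed simp
  let ?h = "\<lambda>s \<sigma>. exp (\<beta> * ?n) * exp (\<beta> * (\<Sum>(i, j)\<leftarrow>B. \<sigma> i * \<sigma> j) + \<beta> * (s * (\<Sum>k\<leftarrow>?K. \<sigma> k)))"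
  have Z: "(\<Sum>\<sigma>\<in>spins N. ?h s \<sigma>) = exp (\<beta> * ?n) * Zpart N \<beta> B ?K" if s: "s = -1 \<or> s = 1" for s
  proof -
    let ?s = "\<lambda>i\<in>{..<N}. s"
    have "?s \<in> spins N" using s by (auto simp: spins_def)
    from sum_spins_mult[OF this, of "?h s"]
    have "(\<Sum>\<sigma>\<in>spins N. ?h s \<sigma>) = (\<Sum>\<sigma>\<in>spins N. ?h s (\<lambda>i\<in>{..<N}. \<sigma> i * ?s i))" .
    also have "\<dots> = (\<Sum>\<sigma>\<in>spins N. ?h 1 \<sigma>)"
    proof (intro sum.cong refl)
      fix \<sigma> :: "nat \<Rightarrow> real"
      let ?\<tau> = "\<lambda>i\<in>{..<N}. \<sigma> i * ?s i"
      have "(\<Sum>(i, j)\<leftarrow>B. ?\<tau> i * ?\<tau> j) = (\<Sum>(i, j)\<leftarrow>B. \<sigma> i * \<sigma> j)"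
        using B s by (intro arg_cong[where f = sum_list] map_cong) auto
      moreover have "s * (\<Sum>k\<leftarrow>?K. ?\<tau> k) = (\<Sum>k\<leftarrow>?K. \<sigma> k)"
        unfolding sum_list_const_mult[symmetric]
        using K s by (intro arg_cong[where f = sum_list] map_cong) auto
      ultimately show "?h s ?\<tau> = ?h 1 \<sigma>" by (simp del: map_map)
    qed
    finally show ?thesis by (simp add: Zpart_def sum_distrib_left del: map_map)
  qed
  have spins: "spins (Suc N) = (\<lambda>(s, \<sigma>). \<sigma>(N := s)) ` ({-1, 1} \<times> spins N)"
    unfolding spins_def lessThan_Suc by (rule PiE_insert_eq)
  have inj: "inj_on (\<lambda>(s, \<sigma>). \<sigma>(N := s)) ({-1, 1} \<times> spins N)"
    unfolding spins_def by (rule inj_combinator) simp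
  have "Zpart (Suc N) \<beta> E [] =
      (\<Sum>(s, \<sigma>)\<in>{-1, 1} \<times> spins N. exp (\<beta> * (\<Sum>(i, j)\<leftarrow>E. (\<sigma>(N := s)) i * (\<sigma>(N := s)) j)))"
    unfolding Zpart_def spins sum.reindex[OF inj] by (simp add: split_beta del: fun_upd_apply)
  also have "\<dots> = (\<Sum>s\<in>{-1, 1}. \<Sum>\<sigma>\<in>spins N. ?h s \<sigma>)"
    unfolding sum.cartesian_product
  proof (intro sum.cong refl, clarify)
    fix s :: real and \<sigma> assume "s \<in> {-1, 1}"
    then have s: "s = -1 \<or> s = 1" by auto
    show "exp (\<beta> * (\<Sum>(i, j)\<leftarrow>E. (\<sigma>(N := s)) i * (\<sigma>(N := s)) j)) = ?h s \<sigma>"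
      by (simp only: energy[OF s] exp_add distrib_left mult.assoc)
  qed
  also have "\<dots> = (\<Sum>s\<in>{-1, 1::real}. exp (\<beta> * ?n) * Zpart N \<beta> B ?K)"
    by (intro sum.cong refl Z) auto
  also have "\<dots> = 2 * exp (\<beta> * ?n) * Zpart N \<beta> B ?K" by simp
  finally show ?thesis .
qed

subsection \<open>Increments and convexity\<close>

text \<open>Summing the increments from \<open>K\<close> on puts a line of slope \<open>m\<close>
  below the sequence; after division by \<open>n\<close> the offset of the line disappears.\<close>

lemma eventually_increment_ge_imp_slope_ge:
  fixes x :: "nat \<Rightarrow> real"
  assumes inc: "eventually (\<lambda>n. x (Suc n) - x n \<ge> m) sequentially"
    and lim: "(\<lambda>n. x n / real n) \<longlonglongrightarrow> a"
  shows "m \<le> a"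
proof -
  obtain K where K: "\<And>n. n \<ge> K \<Longrightarrow> x (Suc n) - x n \<ge> m"
    using inc by (auto simp: eventually_sequentially)
  have *: "x K + m * (real n - real K) \<le> x n" if "n \<ge> K" for n
    using that
  proof (induction n rule: dec_induct)
    case (step n)
    then show ?case using K[of n] by (simp add: algebra_simps)
  qed simp
  have "(\<lambda>n. (x K - m * real K) * inverse (real n) + m) \<longlonglongrightarrow> (x K - m * real K) * 0 + m"
    by (intro tendsto_intros lim_inverse_n)
  moreover have "eventually (\<lambda>n. (x K - m * real K) * inverse (real n) + m \<le> x n / real n) sequentially"
    using eventually_ge_at_top[of "Suc K"]
  proof eventually_elim
    case (elim n)
    then have "(x K - m * real K) * inverse (real n) + m = (x K + m * (real n - real K)) / real n"
      by (simp add: field_simps)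
    also have "\<dots> \<le> x n / real n"
      using elim by (intro divide_right_mono *) auto
    finally show ?case .
  qed
  ultimately show ?thesis
    using tendsto_le[OF _ lim] by fastforce
qed

lemma increments_tendsto_imp_slope_eq:
  fixes x :: "nat \<Rightarrow> real"
  assumes inc: "(\<lambda>n. x (Suc n) - x n) \<longlonglongrightarrow> c"
    and lim: "(\<lambda>n. x n / real n) \<longlonglongrightarrow> a"
  shows "a = c"
proof (rule antisym)
  show "c \<le> a"
  proof (rule dense_le)
    fix m assume "m < c"
    with inc have "eventually (\<lambda>n. x (Suc n) - x n > m) sequentially"
      by (rule order_tendstoD)
    then have "eventually (\<lambda>n. x (Suc n) - x n \<ge> m) sequentially" by eventually_elim simp
    then show "m \<le> a" using lim by (rule eventually_increment_ge_imp_slope_ge)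
  qed
  show "a \<le> c"
  proof (rule dense_ge)
    fix m assume "c < m"
    with inc have "eventually (\<lambda>n. x (Suc n) - x n < m) sequentially"
      by (rule order_tendstoD)
    then have "eventually (\<lambda>n. - x (Suc n) - - x n \<ge> - m) sequentially" by eventually_elim simp
    moreover have "(\<lambda>n. - x n / real n) \<longlonglongrightarrow> - a" using tendsto_minus[OF lim] by simp
    ultimately have "- m \<le> - a" by (rule eventually_increment_ge_imp_slope_ge)
    then show "a \<le> m" by simp
  qed
qed

text \<open>Convexity squeezes the difference quotient over a shrinking step between those over
  fixed steps \<open>h\<close> on either side, whose limits are difference quotients of \<open>A\<close>.\<close>
lemma convex_shrinking_slope_tendsto:
  fixes f :: "nat \<Rightarrow> real \<Rightarrow> real"
  assumes I: "open I" "a \<in> I"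
    and conv: "eventually (\<lambda>n. convex_on I (f n)) sequentially"
    and lim: "\<And>x. x \<in> I \<Longrightarrow> (\<lambda>n. f n x) \<longlonglongrightarrow> A x"
    and deriv: "(A has_real_derivative D) (at a)"
    and d: "d \<longlonglongrightarrow> 0" "eventually (\<lambda>n. d n > 0) sequentially"
  shows "(\<lambda>n. (f n a - f n (a - d n)) / d n) \<longlonglongrightarrow> D"
proof -
  obtain e where e: "e > 0" "ball a e \<subseteq> I" using I by (meson openE)
  have inI: "a + h \<in> I" if "\<bar>h\<bar> < e" for h
    using e that by (auto simp: dist_real_def)
  let ?q = "\<lambda>h. (A (a + h) - A a) / h"
  have q: "(?q \<longlongrightarrow> D) (at 0)" using deriv by (simp add: DERIV_def)
  let ?s = "\<lambda>n. (f n a - f n (a - d n)) / d n"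
  \<comment> \<open>Once \<open>d n < h\<close>, the interval of the shrinking quotient is nested in
    \<open>[a - h, a]\<close> and adjoins \<open>[a, a + h]\<close>, the two positions in which
    convexity compares slopes.\<close>
  have small: "eventually (\<lambda>n. d n < h) sequentially" if "h > 0" for h
    using order_tendstoD(2)[OF d(1)] that by auto
  have up: "eventually (\<lambda>n. ?s n \<le> (f n (a + h) - f n a) / h) sequentially" if h: "0 < h" "h < e" for h
    using conv d(2) small[OF e(1)]
  proof eventually_elim
    case (elim n)
    have "a - d n \<in> I" "a + h \<in> I" using inI[of "- d n"] inI[of h] h elim by auto
    from convex_on_slope_le[OF elim(1) this, of a] h elim
    have "(f n (a - d n) - f n a) / (a - d n - a) \<le> (f n a - f n (a + h)) / (a - (a + h))"
      by linarith
    then show ?case using h elim by (simp add: field_simps)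
  qed
  have lo: "eventually (\<lambda>n. (f n (a - h) - f n a) / (- h) \<le> ?s n) sequentially" if h: "0 < h" "h < e" for h
    using conv d(2) small[OF h(1)]
  proof eventually_elim
    case (elim n)
    have "a - h \<in> I" "a \<in> I" using inI[of "- h"] I h elim by auto
    from convex_on_slope_le(2)[OF elim(1) this, of "a - d n"] h elim
    have "(f n (a - h) - f n a) / (a - h - a) \<le> (f n (a - d n) - f n a) / (a - d n - a)"
      by linarith
    then show ?case using h elim by (simp add: field_simps)
  qed
  show ?thesis
  proof (rule order_tendstoI)
    fix m assume "m < D"
    with q have "eventually (\<lambda>h. m < ?q h) (at 0)" by (rule order_tendstoD)
    then obtain k where k: "k > 0" "\<And>h. h \<noteq> 0 \<Longrightarrow> \<bar>h\<bar> < k \<Longrightarrow> m < ?q h"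
      by (auto simp: eventually_at dist_real_def)
    \<comment> \<open>Strictly below both radii: \<open>k\<close> keeps the quotient of
      \<open>A\<close> above \<open>m\<close>, and \<open>e\<close> keeps \<open>a - h\<close>
      inside \<open>I\<close>, where \<open>f n\<close> converges.\<close>
    define h where "h = min k e / 2"
    have h: "0 < h" "h < e" "h < k" using k e by (auto simp: h_def)
    have m: "m < ?q (- h)" using k(2)[of "- h"] h by simp
    have "(\<lambda>n. (f n (a - h) - f n a) / (- h)) \<longlonglongrightarrow> ?q (- h)"
      using inI[of "- h"] h I by (auto intro!: tendsto_intros lim simp: field_simps)
    then have "eventually (\<lambda>n. m < (f n (a - h) - f n a) / (- h)) sequentially"
      using m by (rule order_tendstoD)
    with lo[OF h(1,2)] show "eventually (\<lambda>n. m < ?s n) sequentially"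
      by eventually_elim linarith
  next
    fix m assume "D < m"
    with q have "eventually (\<lambda>h. ?q h < m) (at 0)" by (rule order_tendstoD)
    then obtain k where k: "k > 0" "\<And>h. h \<noteq> 0 \<Longrightarrow> \<bar>h\<bar> < k \<Longrightarrow> ?q h < m"
      by (auto simp: eventually_at dist_real_def)
    define h where "h = min k e / 2"
    have h: "0 < h" "h < e" "h < k" using k e by (auto simp: h_def)
    have m: "?q h < m" using k(2)[of h] h by simp
    have "(\<lambda>n. (f n (a + h) - f n a) / h) \<longlonglongrightarrow> ?q h"
      using inI[of h] h I by (auto intro!: tendsto_intros lim)
    then have "eventually (\<lambda>n. (f n (a + h) - f n a) / h < m) sequentially"
      using m by (rule order_tendstoD)
    with up[OF h(1,2)] show "eventually (\<lambda>n. ?s n < m) sequentially"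
      by eventually_elim linarith
  qed
qed

subsection \<open>The cavity recursion and the limit\<close>

lemma pair_pmf_of_set:
  assumes "finite A" "A \<noteq> {}" "finite B" "B \<noteq> {}"
  shows "pair_pmf (pmf_of_set A) (pmf_of_set B) = pmf_of_set (A \<times> B)"
proof (rule pmf_eqI, clarify)
  fix x y
  have "A \<times> B \<noteq> {}" "finite (A \<times> B)" using assms by auto
  then show "pmf (pair_pmf (pmf_of_set A) (pmf_of_set B)) (x, y) = pmf (pmf_of_set (A \<times> B)) (x, y)"
    using assms by (simp add: pmf_pair indicator_def card_cartesian_product)
qed

lemma edges_dist_eq:
  assumes "N > 0" "a > 0"
  shows "edges_dist N a = poisson_list (a * N) (pmf_of_set ({..<N} \<times> {..<N}))"
proof -
  have "\<not> a * N \<le> 0" using assms by (simp add: not_le)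
  moreover have "{..<N} \<noteq> {}" using assms by auto
  ultimately show ?thesis
    by (simp add: edges_dist_def poisson_dist_def poisson_list_def pair_pmf_of_set)
qed

lemma field_dist_eq: "a > 0 \<Longrightarrow> field_dist N a 1 = poisson_list (2 * a) (pmf_of_set {..<N})"
  by (simp add: field_dist_def poisson_dist_def poisson_list_def)

lemma set_pmf_edges_dist:
  assumes "N > 0" "a > 0"
  shows "set_pmf (edges_dist N a) = lists ({..<N} \<times> {..<N})"
  using assms by (subst edges_dist_eq) (auto simp: set_pmf_poisson_list lessThan_empty_iff)

lemma set_pmf_field_dist:
  assumes "N > 0" "a > 0"
  shows "set_pmf (field_dist N a 1) = lists {..<N}"
  using assms by (subst field_dist_eq) (auto simp: set_pmf_poisson_list lessThan_empty_iff)

text \<open>Every old site \<open>k\<close> has exactly the two preimages \<open>(k, N)\<close> and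
  \<open>(N, k)\<close>, so the old end of a uniform bond to the last site is again uniform.\<close>

lemma map_min_pmf_of_set:
  assumes "N > 0"
  shows "map_pmf (\<lambda>(i, j). min i j) (pmf_of_set ({..<N} \<times> {N} \<union> {N} \<times> {..<N})) = pmf_of_set {..<N}"
    and "card ({..<N} \<times> {N} \<union> {N} \<times> {..<N}) = 2 * N"
proof -
  let ?F = "{..<N} \<times> {N} \<union> {N} \<times> {..<N}"
  show card: "card ?F = 2 * N" by (subst card_Un_disjoint) auto
  have F: "finite ?F" "?F \<noteq> {}" and N: "finite {..<N}" "{..<N} \<noteq> {}" using assms by auto
  show "map_pmf (\<lambda>(i, j). min i j) (pmf_of_set ?F) = pmf_of_set {..<N}"
  proof (rule pmf_eqI)
    fix k
    have "?F \<inter> (\<lambda>(i, j). min i j) -` {k} = (if k < N then {(k, N), (N, k)} else {})"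
      by (auto simp: min_def split: if_splits)
    then have "card (?F \<inter> (\<lambda>(i, j). min i j) -` {k}) = (if k < N then 2 else 0)"
      by simp
    then show "pmf (map_pmf (\<lambda>(i, j). min i j) (pmf_of_set ?F)) k = pmf (pmf_of_set {..<N}) k"
      unfolding pmf_map measure_pmf_of_set[OF F(2,1)] card pmf_of_set[OF N(2,1)]
      by (simp add: indicator_def)
  qed
qed

text \<open>Thinning is applied twice: first old bonds against those touching \<open>N\<close>, then
  loops among the latter. Of the loops only their number matters, of the remaining bonds only the
  old end.\<close>

lemma edges_dist_Suc:
  fixes N :: nat and a :: real
  assumes N: "N > 0" and a: "a > 0"
  defines "bulk \<equiv> (\<lambda>e. e \<in> {..<N} \<times> {..<N})" and "loop \<equiv> (\<lambda>e. e = (N, N))"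
    and "a' \<equiv> real N / real (N + 1) * a"
  defines "R \<equiv> filter (\<lambda>e. \<not> bulk e)"
  shows "map_pmf (\<lambda>E. (filter bulk E, length (filter loop (R E)),
             map (\<lambda>(i, j). min i j) (filter (\<lambda>e. \<not> loop e) (R E)))) (edges_dist (Suc N) a) =
         pair_pmf (edges_dist N a') (pair_pmf (poisson_pmf (a / (N + 1))) (field_dist N a' 1))"
proof -
  let ?S = "{..<Suc N} \<times> {..<Suc N}" and ?A = "{..<N} \<times> {..<N}"
  let ?F = "{..<N} \<times> {N} \<union> {N} \<times> {..<N}"
  let ?R = "insert (N, N) ?F"
  let ?m = "map (\<lambda>(i, j). min i j)"
  let ?\<phi> = "(\<lambda>(x, y). (length x, ?m y)) \<circ> partition loop"
  have a': "a' > 0" using N a by (simp add: a'_def)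
  have cF: "card ?F = 2 * N" by (rule map_min_pmf_of_set(2)[OF N])
  have cR: "card ?R = 2 * N + 1" by (subst card_insert_disjoint) (auto simp: cF)
  have cA: "card ?A = N * N" and cS: "card ?S = (N + 1) * (N + 1)" by simp_all
  have "map_pmf (partition bulk) (poisson_list (a * Suc N) (pmf_of_set ?S)) =
    pair_pmf (poisson_list (a * Suc N * card ?A / card ?S) (pmf_of_set ?A))
             (poisson_list (a * Suc N * card ?R / card ?S) (pmf_of_set ?R))"
    using N a by (intro partition_poisson_list) (auto simp: bulk_def)
  also have "a * Suc N * card ?A / card ?S = a' * N"
    unfolding cA cS a'_def of_nat_mult by (simp del: of_nat_Suc)
  also have "a * Suc N * card ?R / card ?S = a * card ?R / (N + 1)" (is "_ = ?r")
    unfolding cS of_nat_mult by (simp del: of_nat_Suc)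
  finally have 1: "map_pmf (partition bulk) (edges_dist (Suc N) a) =
      pair_pmf (edges_dist N a') (poisson_list ?r (pmf_of_set ?R))"
    using N a a' by (simp add: edges_dist_eq del: partition_filter_conv)
  have r: "?r > 0" using a unfolding cR by simp
  have "map_pmf (partition loop) (poisson_list ?r (pmf_of_set ?R)) =
    pair_pmf (poisson_list (?r * card {(N, N)} / card ?R) (pmf_of_set {(N, N)}))
             (poisson_list (?r * card ?F / card ?R) (pmf_of_set ?F))"
    using N r by (intro partition_poisson_list) (auto simp: loop_def)
  also have "?r * card {(N, N)} / card ?R = a / (N + 1)"
    unfolding cR by simp
  also have "?r * card ?F / card ?R = 2 * a'"
    unfolding cR cF by (simp add: a'_def)
  finally have 2: "map_pmf (partition loop) (poisson_list ?r (pmf_of_set ?R)) =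
    pair_pmf (poisson_list (a / (N + 1)) (pmf_of_set {(N, N)})) (poisson_list (2 * a') (pmf_of_set ?F))" .
  have 3: "map_pmf ?\<phi> (poisson_list ?r (pmf_of_set ?R)) =
      pair_pmf (poisson_pmf (a / (N + 1))) (field_dist N a' 1)"
    unfolding map_pmf_compose o_apply 2 map_pair map_length_poisson_list map_poisson_list
      map_min_pmf_of_set(1)[OF N] field_dist_eq[OF a'] ..
  have "map_pmf (\<lambda>E. (filter bulk E, length (filter loop (R E)), ?m (filter (\<lambda>e. \<not> loop e) (R E)))) (edges_dist (Suc N) a)
     = map_pmf (apsnd ?\<phi>) (map_pmf (partition bulk) (edges_dist (Suc N) a))"
    by (simp add: map_pmf_comp R_def o_def)
  also have "\<dots> = pair_pmf (edges_dist N a') (map_pmf ?\<phi> (poisson_list ?r (pmf_of_set ?R)))"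
    unfolding 1 pair_map_pmf2 ..
  finally show ?thesis unfolding 3 .
qed

lemma integrable_ln_Zpart:
  assumes N: "N > 0" and a: "a > 0" and \<beta>: "\<beta> > 0"
  shows "integrable (pair_pmf (edges_dist N a) (field_dist N a 1)) (\<lambda>(E, K). ln (Zpart N \<beta> E K))"
    (is "integrable (measure_pmf ?P) _")
proof (rule Bochner_Integration.integrable_bound)
  have N': "{..<N} \<noteq> {}" using N by auto
  have "integrable (map_pmf fst ?P) (\<lambda>E. real (length E))"
    unfolding map_fst_pair_pmf edges_dist_eq[OF N a]
    using N a by (intro integrable_poisson_list[where a = 0 and b = 1]) auto
  moreover have "integrable (map_pmf snd ?P) (\<lambda>K. real (length K))"
    unfolding map_snd_pair_pmf field_dist_eq[OF a]
    using a by (intro integrable_poisson_list[where a = 0 and b = 1]) auto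
  ultimately show "integrable ?P (\<lambda>x. real N * ln 2 + \<beta> * (length (fst x) + length (snd x)))"
    by (simp add: distrib_left)
  show "AE x in ?P. norm (case x of (E, K) \<Rightarrow> ln (Zpart N \<beta> E K))
      \<le> norm (real N * ln 2 + \<beta> * (length (fst x) + length (snd x)))"
  proof (clarsimp simp: AE_measure_pmf_iff set_pmf_edges_dist[OF N a] set_pmf_field_dist[OF N a])
    fix E K assume *: "\<forall>x\<in>set E. x \<in> {..<N} \<times> {..<N}" "\<forall>x\<in>set K. x < N"
    then have "set E \<subseteq> {..<N} \<times> {..<N}" "set K \<subseteq> {..<N}" by auto
    then show "\<bar>ln (Zpart N \<beta> E K)\<bar> \<le> \<bar>real N * ln 2 + \<beta> * (real (length E) + real (length K))\<bar>"
      using ln_Zpart_nonneg[OF \<beta>, of E N K] ln_Zpart_le[OF \<beta>, of E N K] by auto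
  qed
qed auto

lemma pressure_Suc:
  fixes N :: nat and a \<beta> :: real
  assumes N: "N > 0" and a: "a > 0" and \<beta>: "\<beta> > 0"
  defines "a' \<equiv> real N / real (N + 1) * a"
  shows "real (Suc N) * pressure (Suc N) a \<beta> =
    real N * pressure N a' \<beta> + cavity N a' \<beta> 1 + ln 2 + \<beta> * (a / (N + 1))"
proof -
  have a': "a' > 0" using N a by (simp add: a'_def)
  let ?E = "edges_dist N a'" and ?F = "field_dist N a' 1" and ?Q = "poisson_pmf (a / (N + 1))"
  let ?P = "pair_pmf ?E (pair_pmf ?Q ?F)"
  let ?Z = "\<lambda>(E, K). ln (Zpart N \<beta> E K)"
  have EF: "map_pmf (apsnd snd) ?P = pair_pmf ?E ?F"
    unfolding pair_map_pmf2[symmetric] map_snd_pair_pmf ..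
  have Q: "map_pmf (fst \<circ> snd) ?P = ?Q"
    unfolding map_pmf_compose o_apply map_snd_pair_pmf map_fst_pair_pmf ..
  have iZ: "integrable (pair_pmf ?E ?F) ?Z" by (rule integrable_ln_Zpart[OF N a' \<beta>])
  have iQ: "integrable ?Q real"
    using a by (intro integrable_poisson[where a = 0 and b = 1]) auto
  have iE: "integrable ?E (\<lambda>E. ln (Zpart N \<beta> E []))"
  proof -
    have "\<bar>ln (Zpart N \<beta> E [])\<bar> \<le> real N * ln 2 + \<beta> * real (length E)"
      if "set E \<subseteq> {..<N} \<times> {..<N}" for E
      using ln_Zpart_nonneg[OF \<beta> that, of "[]"] ln_Zpart_le[OF \<beta> that, of "[]"] by simp
    then show ?thesis
      using set_pmf_edges_dist[OF N a'] N a' unfolding edges_dist_eq[OF N a']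
      by (intro integrable_poisson_list) auto
  qed
  have "real (Suc N) * pressure (Suc N) a \<beta> =
    measure_pmf.expectation (edges_dist (Suc N) a) (\<lambda>E. ln (Zpart (Suc N) \<beta> E []))"
    by (simp add: pressure_def)
  also have "\<dots> = measure_pmf.expectation ?P (\<lambda>(E, n, K). ln 2 + \<beta> * real n + ln (Zpart N \<beta> E K))"
    unfolding edges_dist_Suc[OF N a, symmetric, folded a'_def] integral_map_pmf
  \<comment> \<open>Splitting off the last site is valid only for bonds within the
    \<open>Suc N\<close> sites, that is on the support; hence the almost everywhere form.\<close>
  proof (intro integral_cong_AE, goal_cases)
    case 3
    show ?case
    proof (clarsimp simp only: AE_measure_pmf_iff set_pmf_edges_dist[OF zero_less_Suc a] in_lists_conv_set split_conv)
      fix E assume "\<forall>x\<in>set E. x \<in> {..<Suc N} \<times> {..<Suc N}"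
      then have "set E \<subseteq> {..<Suc N} \<times> {..<Suc N}" by auto
      from Zpart_Suc[OF this, of \<beta>] show "ln (Zpart (Suc N) \<beta> E []) =
         ln 2 + \<beta> * real (length (filter (\<lambda>e. e = (N, N)) (filter (\<lambda>e. e \<notin> {..<N} \<times> {..<N}) E))) +
         ln (Zpart N \<beta> (filter (\<lambda>e. e \<in> {..<N} \<times> {..<N}) E)
           (map (\<lambda>(i, j). min i j) (filter (\<lambda>e. e \<noteq> (N, N)) (filter (\<lambda>e. e \<notin> {..<N} \<times> {..<N}) E))))"
        by (simp only: ln_mult_pos Zpart_pos exp_gt_zero zero_less_numeral mult_pos_pos ln_exp)
    qed
  qed auto
  also have "\<dots> = measure_pmf.expectation ?P (\<lambda>x. ln 2 + \<beta> * real ((fst \<circ> snd) x) + ?Z (apsnd snd x))"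
    by (intro Bochner_Integration.integral_cong refl) auto
  also have "\<dots> = ln 2 + \<beta> * measure_pmf.expectation ?P (\<lambda>x. real ((fst \<circ> snd) x)) + measure_pmf.expectation ?P (\<lambda>x. ?Z (apsnd snd x))"
  proof -
    have "integrable ?P (\<lambda>x. ?Z (apsnd snd x))" using iZ unfolding EF[symmetric] integrable_map_pmf_eq .
    moreover have "integrable ?P (\<lambda>x. real ((fst \<circ> snd) x))"
      using iQ by (subst (asm) Q[symmetric]) (simp only: integrable_map_pmf_eq)
    ultimately show ?thesis by simp
  qed
  also have "measure_pmf.expectation ?P (\<lambda>x. real ((fst \<circ> snd) x)) = a / (N + 1)"
  proof -
    have "measure_pmf.expectation ?P (\<lambda>x. real ((fst \<circ> snd) x)) =
        measure_pmf.expectation (map_pmf (fst \<circ> snd) ?P) real"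
      unfolding integral_map_pmf ..
    then show ?thesis using a unfolding Q by (simp add: expectation_poisson_id)
  qed
  also have "measure_pmf.expectation ?P (\<lambda>x. ?Z (apsnd snd x)) = measure_pmf.expectation (pair_pmf ?E ?F) ?Z"
    unfolding EF[symmetric] integral_map_pmf ..
  also have "\<dots> = cavity N a' \<beta> 1 + real N * pressure N a' \<beta>"
  proof -
    \<comment> \<open>The logarithm of the quotient in \<open>cavity\<close> is split into two
      separately integrable terms; the second depends on the bonds alone and yields the pressure of
      the smaller system.\<close>
    have iE': "integrable (pair_pmf ?E ?F) (\<lambda>x. ln (Zpart N \<beta> (fst x) []))"
      using iE by (subst (asm) map_fst_pair_pmf[of ?E ?F, symmetric]) (simp only: integrable_map_pmf_eq)
    have "cavity N a' \<beta> 1 = measure_pmf.expectation (pair_pmf ?E ?F) (\<lambda>x. ?Z x - ln (Zpart N \<beta> (fst x) []))"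
      unfolding cavity_def
      by (intro Bochner_Integration.integral_cong refl) (auto simp: ln_div Zpart_pos less_imp_neq[THEN not_sym])
    also have "\<dots> = measure_pmf.expectation (pair_pmf ?E ?F) ?Z
        - measure_pmf.expectation (pair_pmf ?E ?F) (\<lambda>x. ln (Zpart N \<beta> (fst x) []))"
      by (rule Bochner_Integration.integral_diff[OF iZ iE'])
    also have "measure_pmf.expectation (pair_pmf ?E ?F) (\<lambda>x. ln (Zpart N \<beta> (fst x) []))
        = measure_pmf.expectation (map_pmf fst (pair_pmf ?E ?F)) (\<lambda>E. ln (Zpart N \<beta> E []))"
      unfolding integral_map_pmf ..
    also have "\<dots> = real N * pressure N a' \<beta>"
      using N by (simp add: map_fst_pair_pmf pressure_def)
    finally show ?thesis by simp
  qed
  finally show ?thesis by simp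
qed

text \<open>With \<open>g n\<close> the mean of ln Z over exactly \<open>n\<close> uniform bonds,
  averaging log-supermodularity over two fresh bonds makes the second differences of
  \<open>g\<close> nonnegative. Poissonisation turns this into convexity in the rate, which is
  linear in the connectivity.\<close>

lemma convex_on_pressure:
  assumes N: "N > 0" and \<beta>: "\<beta> > 0"
  shows "convex_on {0<..} (\<lambda>a. pressure N a \<beta>)"
proof -
  let ?D = "pmf_of_set ({..<N} \<times> {..<N})"
  let ?f = "\<lambda>E. ln (Zpart N \<beta> E [])"
  define g where "g = (\<lambda>n. measure_pmf.expectation (replicate_pmf n ?D) ?f)"
  have setD: "set_pmf ?D = {..<N} \<times> {..<N}" using N by (intro set_pmf_of_set) auto
  have finD: "finite (set_pmf ?D)" unfolding setD by simp
  have fin: "finite (set_pmf (replicate_pmf n ?D))" for n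
    using finite_lists_length_eq[OF finD, of n]
    by (rule finite_subset[rotated]) (auto simp: set_replicate_pmf)
  have f0: "0 \<le> ?f E" and f1: "?f E \<le> real N * ln 2 + \<beta> * real (length E)"
    if "set E \<subseteq> set_pmf ?D" for E
    using ln_Zpart_nonneg[OF \<beta>, of E N "[]"] ln_Zpart_le[OF \<beta>, of E N "[]"] that
    unfolding setD by simp_all
  have g: "\<bar>g n\<bar> \<le> real N * ln 2 + \<beta> * real n" for n
  proof -
    have "AE E in replicate_pmf n ?D. 0 \<le> ?f E"
      using f0 by (auto simp: AE_measure_pmf_iff set_replicate_pmf)
    then have "0 \<le> g n" unfolding g_def by (rule integral_nonneg_AE)
    moreover have "g n \<le> real N * ln 2 + \<beta> * real n"
      unfolding g_def
      using f1 by (intro measure_pmf.integral_le_const integrable_measure_pmf_finite fin)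
        (force simp: AE_measure_pmf_iff set_replicate_pmf)
    ultimately show ?thesis by simp
  qed
  have conv: "2 * g (Suc n) \<le> g n + g (Suc (Suc n))" for n
  proof -
    let ?R = "replicate_pmf n ?D"
    \<comment> \<open>A coupling of the systems with \<open>n\<close>, \<open>n + 1\<close> and
      \<open>n + 2\<close> bonds. Adding either fresh bond alone gives the law of
      \<open>n + 1\<close> bonds, which is the source of the factor 2.\<close>
    let ?Q = "pair_pmf ?D (pair_pmf ?D ?R)"
    have finQ: "finite (set_pmf ?Q)" using finD fin by simp
    have int: "integrable ?Q h" for h :: "_ \<Rightarrow> real" by (rule integrable_measure_pmf_finite[OF finQ])
    have "g n = measure_pmf.expectation (map_pmf (snd \<circ> snd) ?Q) ?f"
      unfolding map_pmf_compose o_apply map_snd_pair_pmf g_def ..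
    then have g0: "g n = measure_pmf.expectation ?Q (\<lambda>x. ?f (snd (snd x)))"
      unfolding integral_map_pmf o_apply .
    have "map_pmf (\<lambda>(x, y, E). y # E) ?Q = map_pmf (\<lambda>(x, xs). x # xs) (map_pmf snd ?Q)"
      by (simp add: map_pmf_comp case_prod_unfold)
    then have m1: "map_pmf (\<lambda>(x, y, E). y # E) ?Q = replicate_pmf (Suc n) ?D"
      unfolding map_snd_pair_pmf replicate_pmf_Suc_map .
    have g1: "g (Suc n) = measure_pmf.expectation ?Q (\<lambda>(x, y, E). ?f (y # E))"
      unfolding g_def m1[symmetric] integral_map_pmf by (simp add: case_prod_unfold)
    have "map_pmf (\<lambda>(x, y, E). x # E) ?Q = map_pmf (\<lambda>(x, xs). x # xs) (map_pmf (apsnd snd) ?Q)"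
      by (simp add: map_pmf_comp case_prod_unfold)
    then have m1': "map_pmf (\<lambda>(x, y, E). x # E) ?Q = replicate_pmf (Suc n) ?D"
      unfolding pair_map_pmf2[symmetric] map_snd_pair_pmf replicate_pmf_Suc_map .
    have g1': "g (Suc n) = measure_pmf.expectation ?Q (\<lambda>(x, y, E). ?f (x # E))"
      unfolding g_def m1'[symmetric] integral_map_pmf by (simp add: case_prod_unfold)
    have "map_pmf (\<lambda>(x, y, E). x # y # E) ?Q
        = map_pmf (\<lambda>(x, xs). x # xs) (map_pmf (apsnd (\<lambda>(x, xs). x # xs)) ?Q)"
      by (simp add: map_pmf_comp case_prod_unfold)
    then have m2: "map_pmf (\<lambda>(x, y, E). x # y # E) ?Q = replicate_pmf (Suc (Suc n)) ?D"
      unfolding pair_map_pmf2[symmetric] replicate_pmf_Suc_map .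
    have g2: "g (Suc (Suc n)) = measure_pmf.expectation ?Q (\<lambda>(x, y, E). ?f (x # y # E))"
      unfolding g_def m2[symmetric] integral_map_pmf by (simp add: case_prod_unfold)
    have "2 * g (Suc n) = measure_pmf.expectation ?Q (\<lambda>z. (\<lambda>(x, y, E). ?f (x # E)) z + (\<lambda>(x, y, E). ?f (y # E)) z)"
      by (subst Bochner_Integration.integral_add[OF int int]) (simp flip: g1 g1')
    also have "\<dots> \<le> measure_pmf.expectation ?Q (\<lambda>z. ?f (snd (snd z)) + (\<lambda>(x, y, E). ?f (x # y # E)) z)"
    proof (rule integral_mono_AE[OF int int], unfold AE_measure_pmf_iff, rule ballI)
      fix z assume z: "z \<in> set_pmf ?Q"
      obtain x y E where [simp]: "z = (x, y, E)" by (cases z) auto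
      have *: "set E \<subseteq> {..<N} \<times> {..<N}" "x \<in> {..<N} \<times> {..<N}" "y \<in> {..<N} \<times> {..<N}"
        using z setD by (auto simp: set_replicate_pmf)
      have "ln (Zpart N \<beta> (x # E) [] * Zpart N \<beta> (y # E) [])
          \<le> ln (Zpart N \<beta> E [] * Zpart N \<beta> (x # y # E) [])"
        using Zpart_log_supermodular[OF \<beta> *] by (simp add: Zpart_pos)
      then show "(\<lambda>(x, y, E). ?f (x # E)) z + (\<lambda>(x, y, E). ?f (y # E)) z
          \<le> ?f (snd (snd z)) + (\<lambda>(x, y, E). ?f (x # y # E)) z"
        by (simp add: ln_mult_pos Zpart_pos)
    qed
    also have "\<dots> = g n + g (Suc (Suc n))"
      unfolding g0 g2 by (rule Bochner_Integration.integral_add[OF int int])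
    finally show ?thesis .
  qed
  have p: "pressure N a \<beta> = measure_pmf.expectation (poisson_pmf (a * N)) g / N" if "a > 0" for a
  proof -
    have r: "a * N > 0" using that N by simp
    have "integrable (poisson_list (a * N) ?D) ?f"
      using f0 f1 by (intro integrable_poisson_list[OF r, where a = "real N * ln 2" and b = \<beta>])
        (auto simp: set_pmf_poisson_list[OF r] subset_iff)
    from expectation_poisson_list[OF r finD this f0] show ?thesis
      by (simp add: pressure_def edges_dist_eq[OF N that] g_def)
  qed
  have "convex_on {0<..} (\<lambda>r. measure_pmf.expectation (poisson_pmf r) g)" (is "convex_on _ ?G")
    by (rule convex_on_expectation_poisson[OF g conv])
  have "convex_on {0<..} (\<lambda>a. ?G (a * N) / N)"
  proof (rule convex_onI)
    fix t x y :: real assume *: "0 < t" "t < 1" "x \<in> {0<..}" "y \<in> {0<..}"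
    have "?G ((1 - t) *\<^sub>R (x * N) + t *\<^sub>R (y * N)) \<le> (1 - t) * ?G (x * N) + t * ?G (y * N)"
      using * N by (intro convex_onD[OF \<open>convex_on _ ?G\<close>]) auto
    then have "?G (((1 - t) *\<^sub>R x + t *\<^sub>R y) * N) / N \<le> ((1 - t) * ?G (x * N) + t * ?G (y * N)) / N"
      using N by (intro divide_right_mono) (auto simp: algebra_simps)
    then show "?G (((1 - t) *\<^sub>R x + t *\<^sub>R y) * N) / N \<le> (1 - t) * (?G (x * N) / N) + t * (?G (y * N) / N)"
      by (simp add: add_divide_distrib)
  qed simp
  then show ?thesis by (rule convex_on_cong) (simp add: p)
qed

section \<open>Passage to the limit\<close>

theorem theorem1:
  fixes \<alpha> \<beta> :: real and A :: "real \<Rightarrow> real" and dA \<Psi>1 :: real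
  assumes "\<alpha> > 1/2" and "\<beta> > 0"
    and A_lim: "\<forall>a>1/2. (\<lambda>N. pressure N a \<beta>) \<longlonglongrightarrow> A a"
    and A_deriv: "(A has_real_derivative dA) (at \<alpha>)"
    and Psi_lim: "(\<lambda>N. cavity N (real N / real (N + 1) * \<alpha>) \<beta> 1) \<longlonglongrightarrow> \<Psi>1"
  shows "A \<alpha> = ln 2 - \<alpha> * dA + \<Psi>1"
proof -
  \<comment> \<open>The gap between \<alpha> and \<open>N / (N + 1) * \<alpha>\<close>. It vanishes,
    but \<open>N * d N\<close> tends to \<alpha>, which is the factor in front of
    \<open>dA\<close>.\<close>
  define d where "d = (\<lambda>N. \<alpha> / real (N + 1))"
  define p where "p = (\<lambda>N a. pressure N a \<beta>)"
  let ?s = "\<lambda>N. (p N \<alpha> - p N (\<alpha> - d N)) / d N"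
  have d0: "d \<longlonglongrightarrow> 0"
    unfolding d_def by real_asymp
  have s: "?s \<longlonglongrightarrow> dA"
  proof (rule convex_shrinking_slope_tendsto[OF _ _ _ _ A_deriv d0])
    \<comment> \<open>Openness of the half-line on which the pressures converge leaves room for
      fixed steps on both sides of \<alpha>.\<close>
    show "open {1/2::real<..}" "\<alpha> \<in> {1/2<..}" using assms(1) by auto
    show "(\<lambda>N. p N x) \<longlonglongrightarrow> A x" if "x \<in> {1/2<..}" for x using A_lim that by (auto simp: p_def)
    show "\<forall>\<^sub>F N in sequentially. convex_on {1/2<..} (p N)"
      using eventually_gt_at_top[of 0]
    proof eventually_elim
      case (elim N)
      from convex_on_pressure[OF this assms(2)] show ?case
        unfolding p_def by (rule convex_on_subset) auto
    qed
    show "\<forall>\<^sub>F N in sequentially. 0 < d N" using assms(1) by (auto simp: d_def)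
  qed
  have inc: "cavity N (real N / real (N + 1) * \<alpha>) \<beta> 1 + ln 2 + \<beta> * d N - real N * d N * ?s N
      = real (Suc N) * p (Suc N) \<alpha> - real N * p N \<alpha>" if "N > 0" for N
  proof -
    have "\<alpha> - d N = real N / real (N + 1) * \<alpha>" by (simp add: d_def field_simps)
    moreover have "d N \<noteq> 0" using assms(1) by (simp add: d_def)
    then have "real N * d N * ?s N = real N * p N \<alpha> - real N * p N (\<alpha> - d N)"
      by (simp flip: right_diff_distrib)
    moreover have "real (Suc N) * p (Suc N) \<alpha> = real N * p N (real N / real (N + 1) * \<alpha>)
        + cavity N (real N / real (N + 1) * \<alpha>) \<beta> 1 + ln 2 + \<beta> * d N"
      using pressure_Suc[OF that, of \<alpha> \<beta>] assms(1,2) unfolding p_def d_def by simp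
    ultimately show ?thesis by simp
  qed
  have Nd: "(\<lambda>N. real N * d N) \<longlonglongrightarrow> \<alpha>" unfolding d_def by real_asymp
  have "(\<lambda>N. cavity N (real N / real (N + 1) * \<alpha>) \<beta> 1 + ln 2 + \<beta> * d N - real N * d N * ?s N)
      \<longlonglongrightarrow> \<Psi>1 + ln 2 + \<beta> * 0 - \<alpha> * dA"
    by (intro tendsto_intros Psi_lim d0 s Nd)
  then have "(\<lambda>N. real (Suc N) * p (Suc N) \<alpha> - real N * p N \<alpha>) \<longlonglongrightarrow> \<Psi>1 + ln 2 + \<beta> * 0 - \<alpha> * dA"
    by (rule Lim_transform_eventually)
       (use eventually_gt_at_top[of 0] in eventually_elim, rule inc)
  moreover have "(\<lambda>N. real N * p N \<alpha> / real N) \<longlonglongrightarrow> A \<alpha>"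
  proof (rule Lim_transform_eventually)
    show "(\<lambda>N. p N \<alpha>) \<longlonglongrightarrow> A \<alpha>" using A_lim assms(1) by (simp add: p_def)
    show "\<forall>\<^sub>F N in sequentially. p N \<alpha> = real N * p N \<alpha> / real N"
      using eventually_gt_at_top[of 0] by eventually_elim simp
  qed
  ultimately have "A \<alpha> = \<Psi>1 + ln 2 + \<beta> * 0 - \<alpha> * dA"
    by (rule increments_tendsto_imp_slope_eq)
  then show ?thesis by simp
qed

end
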